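(* Let $\mathfrak{g}$ be a restricted Hom-Lie algebra in characteristic $2$ with twist map $\alpha$ and $2$-structure $x\mapsto x^{[2]_\alpha}$. On the superspace $\mathfrak{h}:=\mathfrak{g}\oplus\Pi(\mathfrak{g})$ there exists a Hom-Lie superalgebra structure defined as follows, for all $x,y\in\mathfrak{g}$: $$[x,y]_{\mathfrak{h}}:=[x,y]_{\mathfrak{g}},\qquad[\Pi(x),y]_{\mathfrak{h}}:=\Pi([x,y]_{\mathfrak{g}}),\qquad s_{\mathfrak{h}}(\Pi(x)):=x^{[2]_\alpha},$$ with twist map given by $\alpha$ on $\mathfrak{g}$ and by $\alpha(\Pi(x)):=\Pi(\alpha(x))$ on $\Pi(\mathfrak{g})$.
   Context: All vector spaces are over a field $\mathbb{K}$ of characteristic $2$. $\Pi$ is the change of parity: $\mathfrak{h}_{\bar 0}=\mathfrak{g}$ and $\mathfrak{h}_{\bar 1}=\Pi(\mathfrak{g})$ is a copy of the vector space $\mathfrak{g}$. The bracket of two odd elements is the polarization of the squaring, $[u,v]_{\mathfrak{h}}:=s_{\mathfrak{h}}(u+v)+s_{\mathfrak{h}}(u)+s_{\mathfrak{h}}(v)$. A map $s$ is a squaring if $s(\lambda x)=\lambda^2 s(x)$ for all $\lambda\in\mathbb{K}$. Hom-Lie algebra in characteristic 2: $(\mathfrak{g},[\cdot,\cdot],\alpha)$ with $[\cdot,\cdot]$ bilinear, $\alpha\in\mathrm{End}(\mathfrak{g})$, $[x,x]=0$, $\alpha([x,y])=[\alpha(x),\alpha(y)]$, and $[\alpha(x),[y,z]]+[\alpha(y),[z,x]]+[\alpha(z),[x,y]]=0$.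 It is restricted if it is equipped with a $2$-structure, i.e. a map $x\mapsto x^{[2]_\alpha}$, $\mathfrak{g}\to\mathfrak{g}$, with $[x^{[2]_\alpha},\alpha(y)]=[\alpha(x),[x,y]]$, $(\lambda x)^{[2]_\alpha}=\lambda^2x^{[2]_\alpha}$, and $(x+y)^{[2]_\alpha}=x^{[2]_\alpha}+y^{[2]_\alpha}+[x,y]$ for all $x,y\in\mathfrak{g}$, $\lambda\in\mathbb{K}$. Hom-Lie superalgebra structure in characteristic 2 on a superspace $\mathfrak{h}=\mathfrak{h}_{\bar 0}\oplus\mathfrak{h}_{\bar 1}$: a symmetric bilinear bracket, a squaring $s:\mathfrak{h}_{\bar 1}\to\mathfrak{h}_{\bar 0}$ and an even $\alpha\in\mathrm{End}(\mathfrak{h})$ such that (i) $(\mathfrak{h}_{\bar 0},[\cdot,\cdot],\alpha|_{\mathfrak{h}_{\bar 0}})$ is a Hom-Lie algebra; (ii) $\mathfrak{h}_{\bar 1}$ is an $\mathfrak{h}_{\bar 0}$-module via the bracket (made two-sided by symmetry): $[\alpha(x),\alpha(v)]=\alpha([x,v])$ and $[[x,y],\alpha(v)]=[\alpha(x),[y,v]]+[\alpha(y),[x,v]]$ for $x,y\in\mathfrak{h}_{\bar 0}$, $v\in\mathfrak{h}_{\bar 1}$; (iii) $(u,v)\mapsto s(u+v)+s(u)+s(v)$ on $\mathfrak{h}_{\bar 1}\times\mathfrak{h}_{\bar 1}$ is bilinear and equals $[u,v]$; (iv) $[s(u),\alpha(y)]=[\alpha(u),[u,y]]$ for $u\in\mathfrak{h}_{\bar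 1}$, $y\in\mathfrak{h}$; $\alpha([x,y])=[\alpha(x),\alpha(y)]$ for $x,y\in\mathfrak{h}$; and $\alpha(s(u))=s(\alpha(u))$ for $u\in\mathfrak{h}_{\bar 1}$.
   Formalization: The formal theorem additionally assumes that α commutes with the 2-structure, α(x^[2]) = (αx)^[2]; this is necessary, since the axiom α(s(u)) = s(α(u)) fails e.g. for abelian 𝔤 = K, x^[2] = x², α = multiplication by c with c² ≠ c. *)

theory Defs
  imports "HOL-Analysis.Product_Vector"
begin

locale vector_space_char2 = vector_space scale
  for scale :: "'k::field \<Rightarrow> 'v::ab_group_add \<Rightarrow> 'v" +
  assumes char2: "CHAR('k) = 2"
begin

definition linear_on :: "'v set \<Rightarrow> 'v set \<Rightarrow> ('v \<Rightarrow> 'v) \<Rightarrow> bool" where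
  "linear_on V W f \<longleftrightarrow>
     f ` V \<subseteq> W \<and>
     (\<forall>x\<in>V. \<forall>y\<in>V. f (x + y) = f x + f y) \<and>
     (\<forall>c. \<forall>x\<in>V. f (scale c x) = scale c (f x))"

definition bilinear_on :: "'v set \<Rightarrow> 'v set \<Rightarrow> 'v set \<Rightarrow> ('v \<Rightarrow> 'v \<Rightarrow> 'v) \<Rightarrow> bool" where
  "bilinear_on U V W f \<longleftrightarrow>
     (\<forall>x\<in>U. linear_on V W (f x)) \<and> (\<forall>y\<in>V. linear_on U W (\<lambda>x. f x y))"

end

text \<open>
  The underlying space is a subspace of an ambient vector space, so that the even part of a
  superspace can itself be a Hom-Lie algebra. Values of the operations outside the carriers
  are irrelevant.
\<close>

locale hom_lie_algebra_char2 = vector_space_char2 scale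
  for scale :: "'k::field \<Rightarrow> 'v::ab_group_add \<Rightarrow> 'v" +
  fixes \<gg> :: "'v set" and br :: "'v \<Rightarrow> 'v \<Rightarrow> 'v" and \<alpha> :: "'v \<Rightarrow> 'v"
  assumes carrier_subspace: "subspace \<gg>"
    and bracket_bilinear: "bilinear_on \<gg> \<gg> \<gg> br"
    and twist_linear: "linear_on \<gg> \<gg> \<alpha>"
    and bracket_self: "x \<in> \<gg> \<Longrightarrow> br x x = 0"
    and twist_bracket: "\<lbrakk>x \<in> \<gg>; y \<in> \<gg>\<rbrakk> \<Longrightarrow> \<alpha> (br x y) = br (\<alpha> x) (\<alpha> y)"
    and hom_jacobi: "\<lbrakk>x \<in> \<gg>; y \<in> \<gg>; z \<in> \<gg>\<rbrakk> \<Longrightarrow>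
      br (\<alpha> x) (br y z) + br (\<alpha> y) (br z x) + br (\<alpha> z) (br x y) = 0"

locale restricted_hom_lie_algebra_char2 = hom_lie_algebra_char2 scale \<gg> br \<alpha>
  for scale :: "'k::field \<Rightarrow> 'v::ab_group_add \<Rightarrow> 'v" and \<gg> br \<alpha> +
  fixes sq :: "'v \<Rightarrow> 'v"
  assumes sq_closed: "x \<in> \<gg> \<Longrightarrow> sq x \<in> \<gg>"
    and sq_bracket: "\<lbrakk>x \<in> \<gg>; y \<in> \<gg>\<rbrakk> \<Longrightarrow> br (sq x) (\<alpha> y) = br (\<alpha> x) (br x y)"
    and sq_scale: "x \<in> \<gg> \<Longrightarrow> sq (scale c x) = scale (c\<^sup>2) (sq x)"
    and sq_add: "\<lbrakk>x \<in> \<gg>; y \<in> \<gg>\<rbrakk> \<Longrightarrow> sq (x + y) = sq x + sq y + br x y"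

locale superspace_char2 = vector_space_char2 scale
  for scale :: "'k::field \<Rightarrow> 'v::ab_group_add \<Rightarrow> 'v" +
  fixes V0 V1 :: "'v set"
  assumes even_subspace: "subspace V0"
    and odd_subspace: "subspace V1"
    and even_Int_odd: "V0 \<inter> V1 = {0}"
begin

definition total :: "'v set" where
  "total = {x + y | x y. x \<in> V0 \<and> y \<in> V1}"

end

locale hom_lie_superalgebra_char2 = superspace_char2 scale V0 V1
  for scale :: "'k::field \<Rightarrow> 'v::ab_group_add \<Rightarrow> 'v" and V0 V1 +
  fixes br :: "'v \<Rightarrow> 'v \<Rightarrow> 'v" and s \<alpha> :: "'v \<Rightarrow> 'v"
  assumes bracket_bilinear: "bilinear_on total total total br"
    and bracket_sym: "\<lbrakk>x \<in> total; y \<in> total\<rbrakk> \<Longrightarrow> br x y = br y x"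
    and squaring_even: "u \<in> V1 \<Longrightarrow> s u \<in> V0"
    and squaring_scale: "u \<in> V1 \<Longrightarrow> s (scale c u) = scale (c\<^sup>2) (s u)"
    and twist_linear: "linear_on total total \<alpha>"
    and twist_even: "\<alpha> ` V0 \<subseteq> V0" "\<alpha> ` V1 \<subseteq> V1"
    and even_hom_lie_algebra: "hom_lie_algebra_char2 scale V0 br \<alpha>"
    and odd_action: "bilinear_on V0 V1 V1 br"
    and odd_action_twist: "\<lbrakk>x \<in> V0; v \<in> V1\<rbrakk> \<Longrightarrow> br (\<alpha> x) (\<alpha> v) = \<alpha> (br x v)"
    and odd_action_bracket: "\<lbrakk>x \<in> V0; y \<in> V0; v \<in> V1\<rbrakk> \<Longrightarrow>
      br (br x y) (\<alpha> v) = br (\<alpha> x) (br y v) + br (\<alpha> y) (br x v)"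
    and polarization_bilinear: "bilinear_on V1 V1 V0 (\<lambda>u v. s (u + v) + s u + s v)"
    and polarization_bracket: "\<lbrakk>u \<in> V1; v \<in> V1\<rbrakk> \<Longrightarrow> s (u + v) + s u + s v = br u v"
    and squaring_bracket: "\<lbrakk>u \<in> V1; y \<in> total\<rbrakk> \<Longrightarrow> br (s u) (\<alpha> y) = br (\<alpha> u) (br u y)"
    and twist_bracket: "\<lbrakk>x \<in> total; y \<in> total\<rbrakk> \<Longrightarrow> \<alpha> (br x y) = br (\<alpha> x) (\<alpha> y)"
    and twist_squaring: "u \<in> V1 \<Longrightarrow> \<alpha> (s u) = s (\<alpha> u)"

text \<open>
  The superspace \<open>\<gg> \<oplus> \<Pi> \<gg>\<close> is realised inside \<open>'v \<times> 'v\<close> with componentwise scalar multiplication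
  \<^const>\<open>module_prod.scale\<close>; its even part is \<open>even_copy ` \<gg>\<close> and its odd part \<open>Parity ` \<gg>\<close>.

  Applied to this superspace, the axiom \<open>twist_squaring\<close> says precisely that \<open>\<alpha>\<close> commutes with the
  2-structure. That does not follow from the axioms of a restricted Hom-Lie algebra: let
  \<open>\<gg>\<close> be the abelian algebra \<open>K\<close> itself with \<open>sq x = x\<^sup>2\<close> and \<open>\<alpha>\<close> multiplication by some \<open>c\<close> with
  \<open>c\<^sup>2 \<noteq> c\<close>. Hence it has to be assumed separately when forming the Hom-Lie superalgebra.
\<close>

definition even_copy :: "'v::zero \<Rightarrow> 'v \<times> 'v" where
  "even_copy x = (x, 0)"

definition Parity :: "'v::zero \<Rightarrow> 'v \<times> 'v" where
  "Parity x = (0, x)"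

end

theory Submission
  imports Defs
begin

text \<open>
  Identify \<open>\<gg> \<oplus> \<Pi> \<gg>\<close> with \<open>\<gg> \<otimes> K[e]/(e\<^sup>2 - 1)\<close>, where \<open>e\<close> is odd and a pair \<open>(x, u)\<close> stands for
  \<open>x + u e\<close>. Since a Lie superalgebra in characteristic \<open>2\<close> carries no signs, extending the bracket
  bilinearly over the commutative ring \<open>K[e]/(e\<^sup>2 - 1)\<close> gives \<open>[x + u e, y + v e] =
  ([x, y] + [u, v]) + ([x, v] + [u, y]) e\<close>, the bracket that the required formulas
  dictate, and every multilinear identity of \<open>\<gg>\<close> carries over componentwise. The identities of the
  odd part are therefore those of \<open>\<gg>\<close> read with a marker \<open>e\<close>: the module axiom is the Hom-Jacobi
  identity, with the sign of \<open>[x, y] = -[y, x]\<close> lost in characteristic \<open>2\<close>.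

  The squaring is not bilinear, but it is only needed on odd elements, where \<open>(u e)\<^sup>2\<close> is \<open>sq u\<close>.
  There its polarization is the bracket by the additivity rule of the 2-structure, because
  the terms \<open>sq u + sq u\<close> cancel, and \<open>[s u, \<alpha> y] = [\<alpha> u, [u, y]]\<close> holds for general \<open>y\<close> since both
  sides are linear in \<open>y\<close> and the rule of the 2-structure applies to either component. That
  \<open>\<alpha>\<close> respects the squaring is the hypothesis \<open>twist_sq\<close>.
\<close>

context vector_space_char2
begin

lemma add_self_char2: "x + x = (0::'v)"
proof -
  have "(1::'k) + 1 = of_nat CHAR('k)"
    by (simp add: char2)
  then have "(1::'k) + 1 = 0"
    by (simp only: of_nat_CHAR)
  then show ?thesis
    by (metis scale_left_distrib scale_one scale_zero_left)
qed

lemma add_eq_0_iff_char2: "x + y = 0 \<longleftrightarrow> x = (y::'v)"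
  by (metis add_self_char2 add_left_cancel)

lemma prod_vector_space_char2: "vector_space_char2 (module_prod.scale scale scale)"
proof -
  interpret P: vector_space_prod scale scale ..
  show ?thesis
    by unfold_locales (rule char2)
qed

lemma prod_scale: "module_prod.scale scale scale c (x, y) = (scale c x, scale c y)"
proof -
  interpret P: vector_space_prod scale scale ..
  show ?thesis
    by (simp add: P.scale_def)
qed

end

text \<open>This is the multiplication rule of pairs \<open>(x, u) = x + u e\<close> with \<open>e\<close> central and \<open>e\<^sup>2 = 1\<close>.\<close>

definition ext_bracket :: "('v \<Rightarrow> 'v \<Rightarrow> 'v) \<Rightarrow> 'v \<times> 'v \<Rightarrow> 'v \<times> 'v \<Rightarrow> 'v::plus \<times> 'v" where
  "ext_bracket br p q =
     (br (fst p) (fst q) + br (snd p) (snd q), br (fst p) (snd q) + br (snd p) (fst q))"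

definition odd_squaring :: "('v \<Rightarrow> 'v) \<Rightarrow> 'v \<times> 'v \<Rightarrow> 'v::zero \<times> 'v" where
  "odd_squaring sq p = even_copy (sq (snd p))"

lemma ext_bracket_Pair:
  "ext_bracket br (x, u) (y, v) = (br x y + br u v, br x v + br u y)"
  by (simp add: ext_bracket_def)

context hom_lie_algebra_char2
begin

lemma zero_closed: "0 \<in> \<gg>"
  and add_closed: "x \<in> \<gg> \<Longrightarrow> y \<in> \<gg> \<Longrightarrow> x + y \<in> \<gg>"
  and scale_closed: "x \<in> \<gg> \<Longrightarrow> scale c x \<in> \<gg>"
  using carrier_subspace by (auto simp: subspace_def)

lemma bracket_closed: "x \<in> \<gg> \<Longrightarrow> y \<in> \<gg> \<Longrightarrow> br x y \<in> \<gg>"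
  and bracket_add_left: "x \<in> \<gg> \<Longrightarrow> y \<in> \<gg> \<Longrightarrow> z \<in> \<gg> \<Longrightarrow> br (x + y) z = br x z + br y z"
  and bracket_add_right: "x \<in> \<gg> \<Longrightarrow> y \<in> \<gg> \<Longrightarrow> z \<in> \<gg> \<Longrightarrow> br x (y + z) = br x y + br x z"
  and bracket_scale_left: "x \<in> \<gg> \<Longrightarrow> y \<in> \<gg> \<Longrightarrow> br (scale c x) y = scale c (br x y)"
  and bracket_scale_right: "x \<in> \<gg> \<Longrightarrow> y \<in> \<gg> \<Longrightarrow> br x (scale c y) = scale c (br x y)"
  using bracket_bilinear by (auto simp: bilinear_on_def linear_on_def image_subset_iff)

lemma twist_closed: "x \<in> \<gg> \<Longrightarrow> \<alpha> x \<in> \<gg>"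
  and twist_add: "x \<in> \<gg> \<Longrightarrow> y \<in> \<gg> \<Longrightarrow> \<alpha> (x + y) = \<alpha> x + \<alpha> y"
  and twist_scale: "x \<in> \<gg> \<Longrightarrow> \<alpha> (scale c x) = scale c (\<alpha> x)"
  using twist_linear by (auto simp: linear_on_def)

lemmas closed = zero_closed add_closed scale_closed bracket_closed twist_closed

lemma bracket_zero_left: "x \<in> \<gg> \<Longrightarrow> br 0 x = 0"
  using bracket_add_left[of 0 0 x] zero_closed by simp

lemma bracket_zero_right: "x \<in> \<gg> \<Longrightarrow> br x 0 = 0"
  using bracket_add_right[of x 0 0] zero_closed by simp

lemma twist_zero: "\<alpha> 0 = 0"
  using twist_add[of 0 0] zero_closed by simp

lemmas zeros = bracket_zero_left bracket_zero_right twist_zero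

lemmas linearity =
  bracket_add_left bracket_add_right bracket_scale_left bracket_scale_right twist_add twist_scale

lemma bracket_commute:
  assumes "x \<in> \<gg>" "y \<in> \<gg>"
  shows "br x y = br y x"
proof -
  have "0 = br (x + y) (x + y)"
    using assms by (simp add: bracket_self closed)
  also have "\<dots> = br x y + br y x"
    using assms bracket_self[of x] bracket_self[of y] by (simp add: linearity closed)
  finally show ?thesis
    by (simp add: add_eq_0_iff_char2)
qed

text \<open>
  In characteristic \<open>2\<close> the Hom-Jacobi identity says that \<open>\<gg>\<close> acts on itself by its bracket; this is
  what makes the odd copy of \<open>\<gg>\<close> a module over the even one.
\<close>

lemma adjoint_action:
  assumes "x \<in> \<gg>" "y \<in> \<gg>" "z \<in> \<gg>"
  shows "br (br x y) (\<alpha> z) = br (\<alpha> x) (br y z) + br (\<alpha> y) (br x z)"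
proof -
  have "br (\<alpha> x) (br y z) + br (\<alpha> y) (br x z) + br (br x y) (\<alpha> z) = 0"
    using hom_jacobi[OF assms] assms
    by (simp add: bracket_commute[of z x] bracket_commute[of "br x y" "\<alpha> z"] closed)
  then show ?thesis
    by (simp add: add_eq_0_iff_char2)
qed

lemma ext_bracket_bilinear:
  "vector_space_char2.bilinear_on (module_prod.scale scale scale)
     (\<gg> \<times> \<gg>) (\<gg> \<times> \<gg>) (\<gg> \<times> \<gg>) (ext_bracket br)"
proof -
  interpret P: vector_space_char2 "module_prod.scale scale scale"
    by (rule prod_vector_space_char2)
  show ?thesis
    by (auto simp: P.bilinear_on_def P.linear_on_def ext_bracket_Pair prod_scale closed linearity
        scale_right_distrib add_ac)
qed

lemma even_copy_hom_lie_algebra: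
  "hom_lie_algebra_char2 (module_prod.scale scale scale) (even_copy ` \<gg>)
     (ext_bracket br) (map_prod \<alpha> \<alpha>)"
proof -
  interpret P: vector_space_char2 "module_prod.scale scale scale"
    by (rule prod_vector_space_char2)
  show ?thesis
    by unfold_locales
      (auto simp: P.subspace_def P.bilinear_on_def P.linear_on_def even_copy_def ext_bracket_Pair
        prod_scale zero_prod_def image_iff closed zeros linearity bracket_self twist_bracket
        hom_jacobi)
qed

lemma even_odd_superspace:
  "superspace_char2 (module_prod.scale scale scale) (even_copy ` \<gg>) (Parity ` \<gg>)"
proof -
  interpret P: vector_space_char2 "module_prod.scale scale scale"
    by (rule prod_vector_space_char2)
  show ?thesis
    by unfold_locales
      (auto simp: P.subspace_def even_copy_def Parity_def prod_scale zero_prod_def image_iff closed)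
qed

lemma total_even_odd:
  "superspace_char2.total (even_copy ` \<gg>) (Parity ` \<gg>) = \<gg> \<times> \<gg>"
proof -
  interpret P: superspace_char2 "module_prod.scale scale scale" "even_copy ` \<gg>" "Parity ` \<gg>"
    by (rule even_odd_superspace)
  show ?thesis
    unfolding P.total_def by (force simp: even_copy_def Parity_def)
qed

end

context restricted_hom_lie_algebra_char2
begin

text \<open>
  The additivity rule of the 2-structure, solved for the bracket: in characteristic \<open>2\<close> adding the
  two extra terms removes them. Hence the bracket of odd elements is forced by the squaring.
\<close>

lemma polarization:
  assumes "x \<in> \<gg>" "y \<in> \<gg>"
  shows "sq (x + y) + sq x + sq y = br x y"
proof -
  have "sq (x + y) + sq x + sq y = br x y + (sq x + sq x) + (sq y + sq y)"
    using assms by (simp add: sq_add ac_simps)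
  then show ?thesis
    by (simp add: add_self_char2)
qed

lemma odd_polarization:
  assumes "u \<in> Parity ` \<gg>" "v \<in> Parity ` \<gg>"
  shows "odd_squaring sq (u + v) + odd_squaring sq u + odd_squaring sq v = ext_bracket br u v"
  using assms
  by (auto simp: odd_squaring_def even_copy_def Parity_def ext_bracket_Pair polarization zeros closed)

lemma hom_lie_superalgebra:
  assumes twist_sq: "\<And>x. x \<in> \<gg> \<Longrightarrow> \<alpha> (sq x) = sq (\<alpha> x)"
  shows "hom_lie_superalgebra_char2 (module_prod.scale scale scale)
    (even_copy ` \<gg>) (Parity ` \<gg>) (ext_bracket br) (odd_squaring sq) (map_prod \<alpha> \<alpha>)"
proof -
  interpret P: superspace_char2 "module_prod.scale scale scale" "even_copy ` \<gg>" "Parity ` \<gg>"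
    by (rule even_odd_superspace)
  have odd_bracket: "P.bilinear_on (Parity ` \<gg>) (Parity ` \<gg>) (even_copy ` \<gg>) (ext_bracket br)"
    by (auto simp: P.bilinear_on_def P.linear_on_def even_copy_def Parity_def ext_bracket_Pair
        prod_scale image_iff closed zeros linearity)
  have odd_sum: "u + v \<in> Parity ` \<gg>" if "u \<in> Parity ` \<gg>" "v \<in> Parity ` \<gg>" for u v
    using that P.odd_subspace by (rule_tac P.subspace_add)
  have odd_scale: "module_prod.scale scale scale c u \<in> Parity ` \<gg>" if "u \<in> Parity ` \<gg>" for c u
    using that P.odd_subspace by (rule_tac P.subspace_scale)
  show ?thesis
    \<comment> \<open>Only the outermost predicate is opened, so that the even part stays a single goal.\<close>
  proof (intro hom_lie_superalgebra_char2.intro hom_lie_superalgebra_char2_axioms.intro,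
      unfold total_even_odd)
    show "superspace_char2 (module_prod.scale scale scale) (even_copy ` \<gg>) (Parity ` \<gg>)"
      by (rule even_odd_superspace)
    show "P.bilinear_on (\<gg> \<times> \<gg>) (\<gg> \<times> \<gg>) (\<gg> \<times> \<gg>) (ext_bracket br)"
      by (rule ext_bracket_bilinear)
    show "ext_bracket br p q = ext_bracket br q p" if "p \<in> \<gg> \<times> \<gg>" "q \<in> \<gg> \<times> \<gg>" for p q
      using that by (auto simp: ext_bracket_Pair bracket_commute add.commute)
    show "odd_squaring sq u \<in> even_copy ` \<gg>" if "u \<in> Parity ` \<gg>" for u
      using that by (auto simp: odd_squaring_def Parity_def sq_closed)
    show "odd_squaring sq (module_prod.scale scale scale c u)
        = module_prod.scale scale scale (c\<^sup>2) (odd_squaring sq u)" if "u \<in> Parity ` \<gg>" for c u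
      using that by (auto simp: odd_squaring_def even_copy_def Parity_def prod_scale sq_scale)
    show "P.linear_on (\<gg> \<times> \<gg>) (\<gg> \<times> \<gg>) (map_prod \<alpha> \<alpha>)"
      by (auto simp: P.linear_on_def prod_scale closed linearity)
    show "map_prod \<alpha> \<alpha> ` even_copy ` \<gg> \<subseteq> even_copy ` \<gg>"
      and "map_prod \<alpha> \<alpha> ` Parity ` \<gg> \<subseteq> Parity ` \<gg>"
      by (auto simp: even_copy_def Parity_def zeros closed)
    show "hom_lie_algebra_char2 (module_prod.scale scale scale) (even_copy ` \<gg>)
        (ext_bracket br) (map_prod \<alpha> \<alpha>)"
      by (rule even_copy_hom_lie_algebra)
    show "P.bilinear_on (even_copy ` \<gg>) (Parity ` \<gg>) (Parity ` \<gg>) (ext_bracket br)"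
      by (auto simp: P.bilinear_on_def P.linear_on_def even_copy_def Parity_def ext_bracket_Pair
          prod_scale image_iff closed zeros linearity)
    show "ext_bracket br (map_prod \<alpha> \<alpha> x) (map_prod \<alpha> \<alpha> v) = map_prod \<alpha> \<alpha> (ext_bracket br x v)"
      if "x \<in> even_copy ` \<gg>" "v \<in> Parity ` \<gg>" for x v
      using that
      by (auto simp: even_copy_def Parity_def ext_bracket_Pair zeros closed twist_bracket)
    show "ext_bracket br (ext_bracket br x y) (map_prod \<alpha> \<alpha> v)
        = ext_bracket br (map_prod \<alpha> \<alpha> x) (ext_bracket br y v)
          + ext_bracket br (map_prod \<alpha> \<alpha> y) (ext_bracket br x v)"
      if "x \<in> even_copy ` \<gg>" "y \<in> even_copy ` \<gg>" "v \<in> Parity ` \<gg>" for x y v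
      using that
      by (auto simp: even_copy_def Parity_def ext_bracket_Pair zeros closed adjoint_action)
    show "P.bilinear_on (Parity ` \<gg>) (Parity ` \<gg>) (even_copy ` \<gg>)
        (\<lambda>u v. odd_squaring sq (u + v) + odd_squaring sq u + odd_squaring sq v)"
      \<comment> \<open>On odd elements the polarization can be rewritten to the bracket, whose bilinearity is known.\<close>
      using odd_bracket odd_sum odd_scale
      by (auto simp: P.bilinear_on_def P.linear_on_def odd_polarization image_subset_iff)
    show "odd_squaring sq (u + v) + odd_squaring sq u + odd_squaring sq v = ext_bracket br u v"
      if "u \<in> Parity ` \<gg>" "v \<in> Parity ` \<gg>" for u v
      using that by (rule odd_polarization)
    show "ext_bracket br (odd_squaring sq u) (map_prod \<alpha> \<alpha> y)
        = ext_bracket br (map_prod \<alpha> \<alpha> u) (ext_bracket br u y)"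
      if "u \<in> Parity ` \<gg>" "y \<in> \<gg> \<times> \<gg>" for u y
      using that
      by (auto simp: odd_squaring_def even_copy_def Parity_def ext_bracket_Pair zeros closed
          sq_closed sq_bracket)
    show "map_prod \<alpha> \<alpha> (ext_bracket br p q)
        = ext_bracket br (map_prod \<alpha> \<alpha> p) (map_prod \<alpha> \<alpha> q)"
      if "p \<in> \<gg> \<times> \<gg>" "q \<in> \<gg> \<times> \<gg>" for p q
      using that by (auto simp: ext_bracket_Pair linearity closed twist_bracket)
    show "map_prod \<alpha> \<alpha> (odd_squaring sq u) = odd_squaring sq (map_prod \<alpha> \<alpha> u)"
      if "u \<in> Parity ` \<gg>" for u
      using that by (auto simp: odd_squaring_def even_copy_def Parity_def zeros twist_sq)
  qed
qed

end

theorem proposition5p3: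
  fixes scale :: "'k::field \<Rightarrow> 'v::ab_group_add \<Rightarrow> 'v"
    and \<gg> :: "'v set"
    and br :: "'v \<Rightarrow> 'v \<Rightarrow> 'v"
    and \<alpha> sq :: "'v \<Rightarrow> 'v"
  assumes "restricted_hom_lie_algebra_char2 scale \<gg> br \<alpha> sq"
    and twist_sq: "\<And>x. x \<in> \<gg> \<Longrightarrow> \<alpha> (sq x) = sq (\<alpha> x)"
  shows "\<exists>(br\<^sub>h :: 'v \<times> 'v \<Rightarrow> 'v \<times> 'v \<Rightarrow> 'v \<times> 'v)
           (s\<^sub>h :: 'v \<times> 'v \<Rightarrow> 'v \<times> 'v) (\<alpha>\<^sub>h :: 'v \<times> 'v \<Rightarrow> 'v \<times> 'v).
           hom_lie_superalgebra_char2 (module_prod.scale scale scale)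
             (even_copy ` \<gg>) (Parity ` \<gg>) br\<^sub>h s\<^sub>h \<alpha>\<^sub>h \<and>
           (\<forall>x\<in>\<gg>. \<forall>y\<in>\<gg>. br\<^sub>h (even_copy x) (even_copy y) = even_copy (br x y)) \<and>
           (\<forall>x\<in>\<gg>. \<forall>y\<in>\<gg>. br\<^sub>h (Parity x) (even_copy y) = Parity (br x y)) \<and>
           (\<forall>x\<in>\<gg>. s\<^sub>h (Parity x) = even_copy (sq x)) \<and>
           (\<forall>x\<in>\<gg>. \<alpha>\<^sub>h (even_copy x) = even_copy (\<alpha> x)) \<and>
           (\<forall>x\<in>\<gg>. \<alpha>\<^sub>h (Parity x) = Parity (\<alpha> x))"
proof -
  interpret restricted_hom_lie_algebra_char2 scale \<gg> br \<alpha> sq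
    by (fact assms(1))
  show ?thesis
    by (rule exI[of _ "ext_bracket br"], rule exI[of _ "odd_squaring sq"],
        rule exI[of _ "map_prod \<alpha> \<alpha>"])
      (use hom_lie_superalgebra[OF twist_sq] in
        \<open>auto simp: ext_bracket_Pair odd_squaring_def even_copy_def Parity_def zeros closed\<close>)
qed

end
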